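(* In a three-dimensional piecewise flat manifold $S^3$ with a dual tessellation by vertex volumes $V_v$, the average Ricci curvature along an edge $\ell$ with vertices $v_1,v_2\in\bar\ell$ is $$\mathrm{Rc}_\ell:=\widetilde{\mathrm{Rc}}(\ell)=\frac{1}{2|\ell|}\big(|\ell_{|V_1}|\,R_{v_1}+|\ell_{|V_2}|\,R_{v_2}\big)-K_\ell ,$$ where $\ell_{|V_1}=\ell\cap V_{v_1}$ and $\ell_{|V_2}=\ell\cap V_{v_2}$.
   Context: A piecewise flat manifold $S^3$ is a simplicial $3$-complex, every simplex of which is a tetrahedron or a face of one, formed from Euclidean tetrahedra whose metrics agree on shared faces. $\mathrm{star}(\sigma)$ is the subspace formed by all simplices whose closure contains $\sigma$. Hinges are the edges. The deficit angle of an edge $h$ is $\epsilon_h=2\pi-\sum_s\theta_s$, with $\theta_s$ the dihedral angles at $h$ of the tetrahedra containing $h$ in their closure. $|\cdot|$ is length or volume as appropriate. Dual tessellation: the vertex volumes $V_v$ are open three-dimensional regions, one for each vertex $v$, such that (i) $v\in V_v$ and $V_v$ contains no other vertex; (ii) they are pairwise disjoint and tessellate $S^3$ (up to boundaries, which meet edges in sets of length zero), with $|S^3|=\sum_v|V_v|$; (iii) only edges in $\mathrm{star}(v)$ intersect $V_v$. Scalar curvature at a vertex: $R_v=\frac{2}{|V_v|}\sum_{h\subset\mathrm{star}(v)}|h\cap V_v|\,\epsilon_h$. Sectional curvature orthogonal to an edge: $K_\ell=\frac{1}{|V_\ell|}\big(|\ell|\epsilon_\ell+\sum_h|h\cap V_\ell|\cos^2\theta_h\,\epsilon_h\big)$,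 summed over the other edges $h$ intersecting $V_\ell$, with $\theta_h$ the angle between $h$ and $\ell$. Here $V_\ell$ is the part of $V_{v_1}\cup V_{v_2}$ lying on the surfaces orthogonal to $\ell$ through points of $\ell$ (extended by development around neighbouring edges). Ricci curvature along $\ell$: at $p\in\ell$ it is obtained from the three-dimensional identity $\mathrm{Rc}(u,u)=\frac12R-K^\perp(u)$, where $u$ is a unit vector and $K^\perp(u)$ is the sectional curvature of the plane orthogonal to $u$, with $u$ tangent to $\ell$, using for $R$ at $p$ the value $R_v$ of the volume $V_v$ containing $p$, and for $K^\perp$ the value $K_\ell$. The average $\widetilde{\mathrm{Rc}}(\ell)$ is the integral of this along $\ell$ divided by $|\ell|$. *)

theory Defs
  imports "HOL-Analysis.Analysis"
begin

(* A piecewise flat 3-manifold is given by the vertex sets T of its tetrahedra together with a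
   function d on pairs of vertices which prescribes the edge lengths. Since d only depends on the
   vertices, the metrics of two tetrahedra agree on a shared face. *)

definition simplices :: "'v set set \<Rightarrow> 'v set set" where
  "simplices T = {s. s \<noteq> {} \<and> (\<exists>t\<in>T. s \<subseteq> t)}"

definition vertices :: "'v set set \<Rightarrow> 'v set" where
  "vertices T = \<Union>T"

definition edges :: "'v set set \<Rightarrow> 'v set set" where
  "edges T = {e \<in> simplices T. card e = 2}"

definition star :: "'v set set \<Rightarrow> 'v set \<Rightarrow> 'v set set" where
  "star T \<sigma> = {s \<in> simplices T. \<sigma> \<subseteq> s}"

(* Points are barycentric coordinate functions. *)

definition open_simplex :: "'v set \<Rightarrow> ('v \<Rightarrow> real) set" where
  "open_simplex s = {x. (\<forall>a\<in>s. 0 < x a) \<and> (\<forall>a. a \<notin> s \<longrightarrow> x a = 0) \<and> sum x s = 1}"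

definition closed_simplex :: "'v set \<Rightarrow> ('v \<Rightarrow> real) set" where
  "closed_simplex s = {x. (\<forall>a\<in>s. 0 \<le> x a) \<and> (\<forall>a. a \<notin> s \<longrightarrow> x a = 0) \<and> sum x s = 1}"

definition vertex_point :: "'v \<Rightarrow> 'v \<Rightarrow> real" where
  "vertex_point v = (\<lambda>a. if a = v then 1 else 0)"

definition realization :: "'v set set \<Rightarrow> ('v \<Rightarrow> real) set" where
  "realization T = (\<Union>t\<in>T. closed_simplex t)"

(* For a locally finite complex the subspace topology inherited from the product topology on
   functions coincides with the usual (weak) topology of the geometric realization. *)

abbreviation realization_top :: "'v set set \<Rightarrow> ('v \<Rightarrow> real) topology" where
  "realization_top T \<equiv> top_of_set (realization T)"

definition placement :: "('v \<Rightarrow> 'v \<Rightarrow> real) \<Rightarrow> 'v set \<Rightarrow> ('v \<Rightarrow> real^3) \<Rightarrow> bool" where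
  "placement d t \<phi> \<longleftrightarrow>
     (\<forall>a\<in>t. \<forall>b\<in>t. dist (\<phi> a) (\<phi> b) = d a b) \<and> inj_on \<phi> t \<and> \<not> affine_dependent (\<phi> ` t)"

definition place :: "('v \<Rightarrow> real^3) \<Rightarrow> 'v set \<Rightarrow> ('v \<Rightarrow> real) \<Rightarrow> real^3" where
  "place \<phi> t x = (\<Sum>a\<in>t. x a *\<^sub>R \<phi> a)"

definition piecewise_flat_manifold :: "'v set set \<Rightarrow> ('v \<Rightarrow> 'v \<Rightarrow> real) \<Rightarrow> bool" where
  "piecewise_flat_manifold T d \<longleftrightarrow>
     (\<forall>t\<in>T. card t = 4) \<and>
     (\<forall>v. finite {t\<in>T. v \<in> t}) \<and>
     (\<forall>t\<in>T. \<exists>\<phi>. placement d t \<phi>) \<and>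
     (\<forall>x\<in>realization T. \<exists>U. x \<in> U \<and> openin (realization_top T) U \<and>
        U homeomorphic (UNIV :: (real^3) set))"

(* Any two placements of a tetrahedron differ by an isometry of Euclidean space, so volumes and
   dihedral angles do not depend on the placement chosen here. *)

definition frame :: "('v \<Rightarrow> 'v \<Rightarrow> real) \<Rightarrow> 'v set \<Rightarrow> 'v \<Rightarrow> real^3" where
  "frame d t = (SOME \<phi>. placement d t \<phi>)"

definition evol :: "'v set set \<Rightarrow> ('v \<Rightarrow> 'v \<Rightarrow> real) \<Rightarrow> ('v \<Rightarrow> real) set \<Rightarrow> ennreal" where
  "evol T d A =
     (\<integral>\<^sup>+ t. emeasure lebesgue (place (frame d t) t ` (A \<inter> closed_simplex t)) \<partial>count_space T)"

definition vol :: "'v set set \<Rightarrow> ('v \<Rightarrow> 'v \<Rightarrow> real) \<Rightarrow> ('v \<Rightarrow> real) set \<Rightarrow> real" where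
  "vol T d A = enn2real (evol T d A)"

(* An arbitrary ordering of a two-element set; nothing below depends on it. *)

definition tail :: "'v set \<Rightarrow> 'v" where
  "tail e = (SOME a. a \<in> e)"

definition head :: "'v set \<Rightarrow> 'v" where
  "head e = (SOME b. b \<in> e \<and> b \<noteq> tail e)"

definition edge_length :: "('v \<Rightarrow> 'v \<Rightarrow> real) \<Rightarrow> 'v set \<Rightarrow> real" where
  "edge_length d e = d (tail e) (head e)"

definition arc_point :: "('v \<Rightarrow> 'v \<Rightarrow> real) \<Rightarrow> 'v set \<Rightarrow> real \<Rightarrow> 'v \<Rightarrow> real" where
  "arc_point d e s =
     (\<lambda>a. if a = tail e then 1 - s / edge_length d e
          else if a = head e then s / edge_length d e else 0)"

definition arc_params :: "('v \<Rightarrow> 'v \<Rightarrow> real) \<Rightarrow> 'v set \<Rightarrow> ('v \<Rightarrow> real) set \<Rightarrow> real set" where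
  "arc_params d e A = {s \<in> {0<..<edge_length d e}. arc_point d e s \<in> A}"

(* The length of the part of the edge e lying in A. *)

definition length_in :: "('v \<Rightarrow> 'v \<Rightarrow> real) \<Rightarrow> 'v set \<Rightarrow> ('v \<Rightarrow> real) set \<Rightarrow> real" where
  "length_in d e A = measure lebesgue (arc_params d e A)"

definition edge_average ::
  "('v \<Rightarrow> 'v \<Rightarrow> real) \<Rightarrow> 'v set \<Rightarrow> (('v \<Rightarrow> real) \<Rightarrow> real) \<Rightarrow> real" where
  "edge_average d e f =
     (LINT s:{0<..<edge_length d e}|lebesgue. f (arc_point d e s)) / edge_length d e"

definition vec_angle :: "real^3 \<Rightarrow> real^3 \<Rightarrow> real" where
  "vec_angle u w = arccos ((u \<bullet> w) / (norm u * norm w))"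

definition orth_part :: "real^3 \<Rightarrow> real^3 \<Rightarrow> real^3" where
  "orth_part u w = w - ((w \<bullet> u) / (u \<bullet> u)) *\<^sub>R u"

definition dihedral_angle :: "('v \<Rightarrow> 'v \<Rightarrow> real) \<Rightarrow> 'v set \<Rightarrow> 'v set \<Rightarrow> real" where
  "dihedral_angle d t h =
     (let \<phi> = frame d t; u = \<phi> (head h) - \<phi> (tail h) in
        vec_angle (orth_part u (\<phi> (tail (t - h)) - \<phi> (tail h)))
                  (orth_part u (\<phi> (head (t - h)) - \<phi> (tail h))))"

definition deficit_angle :: "'v set set \<Rightarrow> ('v \<Rightarrow> 'v \<Rightarrow> real) \<Rightarrow> 'v set \<Rightarrow> real" where
  "deficit_angle T d h = 2 * pi - (\<Sum>t\<in>{t\<in>T. h \<subseteq> t}. dihedral_angle d t h)"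

(* The boundaries are required to be negligible rather than to have length_in equal to 0, because
   measure is also 0 on sets that are not measurable. *)

definition dual_tessellation ::
  "'v set set \<Rightarrow> ('v \<Rightarrow> 'v \<Rightarrow> real) \<Rightarrow> ('v \<Rightarrow> ('v \<Rightarrow> real) set) \<Rightarrow> bool" where
  "dual_tessellation T d V \<longleftrightarrow>
     (\<forall>v\<in>vertices T. openin (realization_top T) (V v)) \<and>
     (\<forall>v\<in>vertices T. \<forall>w\<in>vertices T. vertex_point w \<in> V v \<longleftrightarrow> w = v) \<and>
     disjoint_family_on V (vertices T) \<and>
     realization T = (\<Union>v\<in>vertices T. realization_top T closure_of V v) \<and>
     (\<forall>e\<in>edges T. negligible
        (arc_params d e (\<Union>v\<in>vertices T. realization_top T frontier_of V v))) \<and>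
     evol T d (realization T) = (\<integral>\<^sup>+ v. evol T d (V v) \<partial>count_space (vertices T)) \<and>
     (\<forall>v\<in>vertices T. \<forall>e\<in>edges T. open_simplex e \<inter> V v \<noteq> {} \<longrightarrow> e \<in> star T {v})"

definition scalar_curvature ::
  "'v set set \<Rightarrow> ('v \<Rightarrow> 'v \<Rightarrow> real) \<Rightarrow> ('v \<Rightarrow> ('v \<Rightarrow> real) set) \<Rightarrow> 'v \<Rightarrow> real" where
  "scalar_curvature T d V v =
     2 / vol T d (V v) *
     (\<Sum>h\<in>edges T \<inter> star T {v}. length_in d h (V v) * deficit_angle T d h)"

(* Development of the surface orthogonal to the edge l through its point at arc length s.
   developed T d W l s n t \<phi> says that the surface extends into the tetrahedron t after crossing
   n faces, and that \<phi> is the resulting placement of t. The edge l is laid along the first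
   coordinate axis, starting at the origin, so the surface is the plane y $ 1 = s throughout.
   One starts from the tetrahedra containing l; whenever the plane meets a face shared with a
   further tetrahedron intersecting W, that tetrahedron is unfolded to the other side of the
   face. *)

inductive developed ::
  "'v set set \<Rightarrow> ('v \<Rightarrow> 'v \<Rightarrow> real) \<Rightarrow> ('v \<Rightarrow> real) set \<Rightarrow> 'v set \<Rightarrow> real \<Rightarrow>
   nat \<Rightarrow> 'v set \<Rightarrow> ('v \<Rightarrow> real^3) \<Rightarrow> bool"
  for T d W l s where
  start: "\<lbrakk>t \<in> T; l \<subseteq> t; placement d t \<phi>; \<phi> (tail l) = 0;
           \<phi> (head l) = edge_length d l *\<^sub>R axis 1 1\<rbrakk>
          \<Longrightarrow> developed T d W l s 0 t \<phi>"
| unfold: "\<lbrakk>developed T d W l s n t \<phi>; t' \<in> T; closed_simplex t' \<inter> W \<noteq> {};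
            card (t \<inter> t') = 3; \<exists>x\<in>closed_simplex (t \<inter> t'). place \<phi> t x $ 1 = s;
            placement d t' \<phi>'; \<forall>a\<in>t \<inter> t'. \<phi>' a = \<phi> a;
            interior (convex hull (\<phi> ` t)) \<inter> interior (convex hull (\<phi>' ` t')) = {}\<rbrakk>
          \<Longrightarrow> developed T d W l s (Suc n) t' \<phi>'"

(* Because of the deficit angles, a development depends on the side on which it passes an edge,
   and could even wind around it. Each tetrahedron is therefore developed along shortest sequences
   of unfoldings only. *)

definition orthogonal_surface ::
  "'v set set \<Rightarrow> ('v \<Rightarrow> 'v \<Rightarrow> real) \<Rightarrow> ('v \<Rightarrow> real) set \<Rightarrow> 'v set \<Rightarrow> real \<Rightarrow> ('v \<Rightarrow> real) set"
  where
  "orthogonal_surface T d W l s =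
     {x. \<exists>n t \<phi>. developed T d W l s n t \<phi> \<and>
         (\<forall>m \<psi>. developed T d W l s m t \<psi> \<longrightarrow> n \<le> m) \<and>
         x \<in> closed_simplex t \<and> place \<phi> t x $ 1 = s}"

definition edge_volume ::
  "'v set set \<Rightarrow> ('v \<Rightarrow> 'v \<Rightarrow> real) \<Rightarrow> ('v \<Rightarrow> ('v \<Rightarrow> real) set) \<Rightarrow> 'v set \<Rightarrow> ('v \<Rightarrow> real) set"
  where
  "edge_volume T d V l =
     (\<Union>v\<in>l. V v) \<inter>
     (\<Union>s\<in>{0<..<edge_length d l}. orthogonal_surface T d (\<Union>v\<in>l. V v) l s)"

definition hinges_meeting ::
  "'v set set \<Rightarrow> ('v \<Rightarrow> 'v \<Rightarrow> real) \<Rightarrow> ('v \<Rightarrow> ('v \<Rightarrow> real) set) \<Rightarrow> 'v set \<Rightarrow> 'v set set" where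
  "hinges_meeting T d V l =
     {h \<in> edges T. h \<noteq> l \<and> open_simplex h \<inter> edge_volume T d V l \<noteq> {}}"

(* \<theta> is an angle between the edges h and l, measured in a development of the orthogonal surfaces
   which reaches h in the fewest steps. If h and l lie in a common tetrahedron, this is the angle
   between them in that tetrahedron; otherwise the shortest development need not be unique.
   Reversing the direction of h replaces \<theta> by pi - \<theta>, which does not affect its squared cosine. *)

definition developed_angle ::
  "'v set set \<Rightarrow> ('v \<Rightarrow> 'v \<Rightarrow> real) \<Rightarrow> ('v \<Rightarrow> ('v \<Rightarrow> real) set) \<Rightarrow> 'v set \<Rightarrow> 'v set \<Rightarrow>
   real \<Rightarrow> bool" where
  "developed_angle T d V l h \<theta> \<longleftrightarrow>
     (\<exists>s\<in>{0<..<edge_length d l}. \<exists>n t \<phi>.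
        developed T d (\<Union>v\<in>l. V v) l s n t \<phi> \<and> h \<subseteq> t \<and>
        (\<forall>s'\<in>{0<..<edge_length d l}. \<forall>m t' \<psi>.
           developed T d (\<Union>v\<in>l. V v) l s' m t' \<psi> \<and> h \<subseteq> t' \<longrightarrow> n \<le> m) \<and>
        \<theta> = vec_angle (\<phi> (head h) - \<phi> (tail h)) (axis 1 1))"

definition hinge_angles ::
  "'v set set \<Rightarrow> ('v \<Rightarrow> 'v \<Rightarrow> real) \<Rightarrow> ('v \<Rightarrow> ('v \<Rightarrow> real) set) \<Rightarrow> 'v set \<Rightarrow>
   ('v set \<Rightarrow> real) \<Rightarrow> bool" where
  "hinge_angles T d V l \<theta> \<longleftrightarrow>
     (\<forall>h\<in>hinges_meeting T d V l. developed_angle T d V l h (\<theta> h))"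

definition sectional_curvature ::
  "'v set set \<Rightarrow> ('v \<Rightarrow> 'v \<Rightarrow> real) \<Rightarrow> ('v \<Rightarrow> ('v \<Rightarrow> real) set) \<Rightarrow> 'v set \<Rightarrow>
   ('v set \<Rightarrow> real) \<Rightarrow> real" where
  "sectional_curvature T d V l \<theta> =
     1 / vol T d (edge_volume T d V l) *
     (edge_length d l * deficit_angle T d l +
      (\<Sum>h\<in>hinges_meeting T d V l.
         length_in d h (edge_volume T d V l) * (cos (\<theta> h))\<^sup>2 * deficit_angle T d h))"

definition scalar_curvature_at ::
  "'v set set \<Rightarrow> ('v \<Rightarrow> 'v \<Rightarrow> real) \<Rightarrow> ('v \<Rightarrow> ('v \<Rightarrow> real) set) \<Rightarrow> ('v \<Rightarrow> real) \<Rightarrow> real" where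
  "scalar_curvature_at T d V x = scalar_curvature T d V (THE v. v \<in> vertices T \<and> x \<in> V v)"

(* The three-dimensional identity Rc(u,u) = R/2 - K for the unit tangent u of l, where K is the
   sectional curvature of the plane orthogonal to u. *)

definition ricci_along ::
  "'v set set \<Rightarrow> ('v \<Rightarrow> 'v \<Rightarrow> real) \<Rightarrow> ('v \<Rightarrow> ('v \<Rightarrow> real) set) \<Rightarrow> 'v set \<Rightarrow>
   ('v set \<Rightarrow> real) \<Rightarrow> ('v \<Rightarrow> real) \<Rightarrow> real" where
  "ricci_along T d V l \<theta> x =
     1 / 2 * scalar_curvature_at T d V x - sectional_curvature T d V l \<theta>"

definition average_ricci ::
  "'v set set \<Rightarrow> ('v \<Rightarrow> 'v \<Rightarrow> real) \<Rightarrow> ('v \<Rightarrow> ('v \<Rightarrow> real) set) \<Rightarrow> 'v set \<Rightarrow>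
   ('v set \<Rightarrow> real) \<Rightarrow> real" where
  "average_ricci T d V l \<theta> = edge_average d l (ricci_along T d V l \<theta>)"

end

(* Every open set V v that meets the interior of l belongs to an endpoint of l, and the boundaries
   of these sets are negligible on l. Hence the integrand is a step function: up to a null set it
   takes the value R v / 2 - K on the part of l inside V v, for the two endpoints v of l. *)

theory Submission
  imports Defs
begin

text \<open>With \<open>card l = 2\<close>, the choices defining \<open>tail\<close> and
  \<open>head\<close> are both made from nonempty sets, so \<open>SOME\<close> returns genuine and
  different endpoints.\<close>

lemma edge_endpoints:
  assumes "l \<in> edges T"
  shows "l = {tail l, head l}" and "tail l \<noteq> head l"
proof -
  have "card l = 2"
    using assms by (simp add: edges_def)
  then obtain a b where l: "l = {a, b}" "a \<noteq> b"
    by (meson card_2_iff)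
  have t: "tail l \<in> l"
    unfolding tail_def by (rule someI[of _ a]) (simp add: l)
  then have "\<exists>b. b \<in> l \<and> b \<noteq> tail l"
    using l by auto
  then have "head l \<in> l \<and> head l \<noteq> tail l"
    unfolding head_def by (rule someI_ex)
  with t l show "l = {tail l, head l}" "tail l \<noteq> head l"
    by auto
qed

text \<open>No positivity of \<open>d\<close> is assumed. It comes from a placement of a tetrahedron
  containing \<open>l\<close>, which realizes \<open>d\<close> as a Euclidean distance and is
  injective on vertices.\<close>

lemma edge_length_pos:
  assumes "piecewise_flat_manifold T d" and "l \<in> edges T"
  shows "0 < edge_length d l"
proof -
  obtain t where t: "t \<in> T" "l \<subseteq> t"
    using assms(2) by (auto simp: edges_def simplices_def)
  then obtain \<phi> where \<phi>: "placement d t \<phi>"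
    using assms(1) by (auto simp: piecewise_flat_manifold_def)
  have mem: "tail l \<in> t" "head l \<in> t" "tail l \<noteq> head l"
    using edge_endpoints[OF assms(2)] t by auto
  then have "dist (\<phi> (tail l)) (\<phi> (head l)) = edge_length d l"
    using \<phi> by (simp add: placement_def edge_length_def)
  moreover have "\<phi> (tail l) \<noteq> \<phi> (head l)"
    using \<phi> mem by (auto simp: placement_def inj_on_def)
  ultimately show ?thesis
    by (metis zero_less_dist_iff)
qed

lemma arc_point_in_open_simplex:
  assumes "l \<in> edges T" and "s \<in> {0<..<edge_length d l}"
  shows "arc_point d l s \<in> open_simplex l"
proof -
  have s: "0 < s" "s < edge_length d l"
    using assms(2) by auto
  have *: "sum f l = f (tail l) + f (head l)" for f :: "_ \<Rightarrow> real"
    by (subst edge_endpoints(1)[OF assms(1)]) (simp add: edge_endpoints(2)[OF assms(1)])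
  have "a \<in> l \<longleftrightarrow> a = tail l \<or> a = head l" for a
    using edge_endpoints(1)[OF assms(1)] by blast
  then show ?thesis
    using s edge_endpoints(2)[OF assms(1)]
    by (auto simp: open_simplex_def arc_point_def *)
qed

text \<open>Barycentric coordinates on a face extend by zero to a tetrahedron containing it.
  Finiteness of \<open>t\<close>, read off from \<open>card t = 4\<close>, keeps the coordinate sum
  equal to 1.\<close>

lemma open_simplex_subset_realization:
  assumes "piecewise_flat_manifold T d" and "s \<in> simplices T"
  shows "open_simplex s \<subseteq> realization T"
proof
  fix x assume x: "x \<in> open_simplex s"
  obtain t where t: "t \<in> T" "s \<subseteq> t"
    using assms(2) by (auto simp: simplices_def)
  have "card t = 4"
    using assms(1) t(1) by (simp add: piecewise_flat_manifold_def)
  then have "finite t"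
    by (simp add: card_ge_0_finite)
  then have "sum x t = sum x s"
    using t(2) x by (intro sum.mono_neutral_right) (auto simp: open_simplex_def)
  moreover have "0 \<le> x a" for a
    using x by (cases "a \<in> s") (auto simp: open_simplex_def less_imp_le)
  ultimately have "x \<in> closed_simplex t"
    using x t(2) by (auto simp: closed_simplex_def open_simplex_def)
  with t(1) show "x \<in> realization T"
    by (auto simp: realization_def)
qed

lemma arc_point_in_realization:
  assumes "piecewise_flat_manifold T d" and "l \<in> edges T" and "s \<in> {0<..<edge_length d l}"
  shows "arc_point d l s \<in> realization T"
  using open_simplex_subset_realization[OF assms(1), of l] arc_point_in_open_simplex[OF assms(2,3)]
    assms(2) by (auto simp: edges_def)

lemma continuous_on_arc_point: "continuous_on S (arc_point d l)"
proof (rule continuous_on_coordinatewise_then_product)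
  fix a
  show "continuous_on S (\<lambda>s. arc_point d l s a)"
    \<comment> \<open>Each coordinate is affine in \<open>s\<close>. Writing the quotient as a
      product with a constant inverse avoids a side condition on the length.\<close>
    by (cases "a = tail l"; cases "a = head l")
      (auto simp: arc_point_def divide_inverse intro!: continuous_intros)
qed

text \<open>\<open>U\<close> is only relatively open, but the edge stays inside the realization, so
  pulling back \<open>U\<close> is the same as pulling back an ambient open set along a continuous
  map.\<close>

lemma open_arc_params:
  assumes "piecewise_flat_manifold T d" and "l \<in> edges T"
    and "openin (realization_top T) U"
  shows "open (arc_params d l U)"
proof -
  obtain W where W: "open W" "U = realization T \<inter> W"
    using assms(3) by (auto simp: openin_open)
  have "arc_params d l U = arc_point d l -` W \<inter> {0<..<edge_length d l}"
    using W arc_point_in_realization[OF assms(1,2)] by (auto simp: arc_params_def)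
  then show ?thesis
    using continuous_open_preimage[OF continuous_on_arc_point _ W(1),
        of "{0<..<edge_length d l}" d l]
    by (simp add: Int_commute)
qed

lemma arc_params_lmeasurable:
  assumes "piecewise_flat_manifold T d" and "l \<in> edges T"
    and "openin (realization_top T) U"
  shows "arc_params d l U \<in> lmeasurable"
proof (rule lmeasurable_open)
  show "bounded (arc_params d l U)"
    by (rule bounded_subset[of "{0<..<edge_length d l}"]) (auto simp: arc_params_def)
qed (rule open_arc_params[OF assms])

text \<open>This is where the star condition on the cells enters: it leaves only the two endpoint
  cells to be considered along \<open>l\<close>.\<close>

lemma dual_tessellation_vertex_in_edge:
  assumes "dual_tessellation T d V" and "l \<in> edges T" and "v \<in> vertices T"
    and "s \<in> {0<..<edge_length d l}" and "arc_point d l s \<in> V v"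
  shows "v \<in> l"
proof -
  have "open_simplex l \<inter> V v \<noteq> {}"
    using arc_point_in_open_simplex[OF assms(2,4)] assms(5) by blast
  then have "l \<in> star T {v}"
    using assms(1-3) unfolding dual_tessellation_def by blast
  then show ?thesis
    by (simp add: star_def)
qed

lemma edge_subset_vertices: "l \<in> edges T \<Longrightarrow> l \<subseteq> vertices T"
  by (auto simp: edges_def simplices_def vertices_def)

lemma dual_tessellation_the_vertex:
  assumes "dual_tessellation T d V" and "v \<in> vertices T" and "x \<in> V v"
  shows "(THE w. w \<in> vertices T \<and> x \<in> V w) = v"
proof (rule the_equality)
  fix w assume "w \<in> vertices T \<and> x \<in> V w"
  then show "w = v"
    using assms unfolding dual_tessellation_def disjoint_family_on_def by blast
qed (use assms in simp)

text \<open>The closures of the cells cover the realization. Each cell is open, hence its own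
  interior, so a point of its closure outside it lies on its frontier, and the frontiers are
  negligible along edges.\<close>

lemma negligible_arc_params_uncovered:
  assumes "piecewise_flat_manifold T d" and "dual_tessellation T d V" and "l \<in> edges T"
  shows "negligible ({0<..<edge_length d l} - (\<Union>v\<in>vertices T. arc_params d l (V v)))"
proof (rule negligible_subset)
  show "negligible
      (arc_params d l (\<Union>v\<in>vertices T. realization_top T frontier_of V v))"
    using assms(2,3) by (simp add: dual_tessellation_def)
  have op: "openin (realization_top T) (V v)" if "v \<in> vertices T" for v
    using assms(2) that by (simp add: dual_tessellation_def)
  have cover: "realization T = (\<Union>v\<in>vertices T. realization_top T closure_of V v)"
    using assms(2) by (simp add: dual_tessellation_def)
  show "{0<..<edge_length d l} - (\<Union>v\<in>vertices T. arc_params d l (V v))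
      \<subseteq> arc_params d l (\<Union>v\<in>vertices T. realization_top T frontier_of V v)"
  proof
    fix s assume s: "s \<in> {0<..<edge_length d l} - (\<Union>v\<in>vertices T. arc_params d l (V v))"
    then obtain v where v: "v \<in> vertices T" "arc_point d l s \<in> realization_top T closure_of V v"
      using arc_point_in_realization[OF assms(1,3), of s] cover by blast
    moreover have "arc_point d l s \<notin> V v"
      using s v(1) by (auto simp: arc_params_def)
    ultimately have "arc_point d l s \<in> realization_top T frontier_of V v"
      by (simp add: frontier_of_def interior_of_openin[OF op])
    with s v(1) show "s \<in> arc_params d l (\<Union>v\<in>vertices T. realization_top T frontier_of V v)"
      by (auto simp: arc_params_def)
  qed
qed

theorem theorem6p2:
  fixes T :: "'v set set"
    and d :: "'v \<Rightarrow> 'v \<Rightarrow> real"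
    and V :: "'v \<Rightarrow> ('v \<Rightarrow> real) set"
    and l :: "'v set"
    and v1 v2 :: 'v
    and \<theta> :: "'v set \<Rightarrow> real"
  assumes "piecewise_flat_manifold T d"
    and "dual_tessellation T d V"
    and "l \<in> edges T"
    and "l = {v1, v2}"
    and "hinge_angles T d V l \<theta>"
  shows "average_ricci T d V l \<theta> =
           1 / (2 * edge_length d l) *
             (length_in d l (V v1) * scalar_curvature T d V v1 +
              length_in d l (V v2) * scalar_curvature T d V v2)
           - sectional_curvature T d V l \<theta>"
proof -
  define L where "L = edge_length d l"
  define I where "I = {0<..<L}"
  define R where "R = scalar_curvature T d V"
  define K where "K = sectional_curvature T d V l \<theta>"
  define A where "A v = arc_params d l (V v)" for v
  define N where "N = I - (A v1 \<union> A v2)"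
  (* The junk value that the definite description in scalar_curvature_at yields on the boundaries. *)
  define c where "c = R (THE v. False)"
  have Lpos: "0 < L"
    unfolding L_def by (rule edge_length_pos[OF assms(1,3)])
  have vs: "v1 \<in> vertices T" "v2 \<in> vertices T"
    using edge_subset_vertices[OF assms(3)] assms(4) by auto
  have ne: "v1 \<noteq> v2"
    using assms(3,4) by (auto simp: edges_def)
  have A_meas: "A v \<in> lmeasurable" if "v \<in> vertices T" for v
    unfolding A_def
    using assms(2) that
    by (intro arc_params_lmeasurable[OF assms(1,3)]) (simp add: dual_tessellation_def)
  have A_iff: "s \<in> A v \<longleftrightarrow> s \<in> I \<and> arc_point d l s \<in> V v" for s v
    by (auto simp: A_def arc_params_def I_def L_def)
  have "V v1 \<inter> V v2 = {}"
    using assms(2) vs ne by (simp add: dual_tessellation_def disjoint_family_on_def)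
  then have disj: "A v1 \<inter> A v2 = {}"
    by (auto simp: A_iff)
  have endpoint: "v \<in> {v1, v2}" if "v \<in> vertices T" "s \<in> A v" for v s
    using dual_tessellation_vertex_in_edge[OF assms(2,3) that(1), of s] that(2) assms(4)
    by (simp add: A_iff I_def L_def)
  \<comment> \<open>Cells of other vertices miss the edge, so removing the two endpoint cells
    removes them all and the negligibility lemma applies to \<open>N\<close>.\<close>
  have "N = I - (\<Union>v\<in>vertices T. A v)"
    using endpoint vs by (auto simp: N_def)
  then have N_null: "negligible N"
    using negligible_arc_params_uncovered[OF assms(1-3)] by (simp add: A_def I_def L_def)
  then have N: "N \<in> lmeasurable" "measure lebesgue N = 0"
    by (auto simp: negligible_iff_measure)
  have I: "I \<in> lmeasurable" "measure lebesgue I = L"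
    using Lpos by (auto simp: I_def)
  \<comment> \<open>The term for \<open>N\<close> makes this an identity at every \<open>s\<close>,
    so that no almost-everywhere argument is required when integrating.\<close>
  have step: "indicator I s *\<^sub>R ricci_along T d V l \<theta> (arc_point d l s) =
      R v1 / 2 * indicator (A v1) s + R v2 / 2 * indicator (A v2) s
      + c / 2 * indicator N s - K * indicator I s" for s
  proof -
    have on_cell: "scalar_curvature_at T d V (arc_point d l s) = R v"
      if "v \<in> vertices T" "s \<in> A v" for v
      using dual_tessellation_the_vertex[OF assms(2) that(1)] that(2)
      by (simp add: A_iff scalar_curvature_at_def R_def)
    have on_boundary: "scalar_curvature_at T d V (arc_point d l s) = c" if "s \<in> N"
    proof -
      \<comment> \<open>On \<open>N\<close> the defining predicate is unsatisfiable. Equality of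
        predicates, not mere failure of existence, shows that \<open>THE\<close> yields one and the
        same value for all such \<open>s\<close>.\<close>
      have "(\<lambda>v. v \<in> vertices T \<and> arc_point d l s \<in> V v) = (\<lambda>v. False)"
        using endpoint[of _ s] that by (fastforce simp: N_def A_iff)
      then show ?thesis
        by (simp only: scalar_curvature_at_def c_def R_def)
    qed
    consider "s \<notin> I" | "s \<in> A v1" | "s \<in> A v2" | "s \<in> N"
      by (auto simp: N_def)
    then show ?thesis
    proof cases
      case 1
      then show ?thesis by (auto simp: N_def A_iff)
    next
      case 2
      then have "s \<in> I" "s \<notin> A v2" "s \<notin> N"
        using disj A_iff by (auto simp: N_def)
      with 2 on_cell[OF vs(1)] show ?thesis
        by (simp add: ricci_along_def K_def)
    next
      case 3
      then have "s \<in> I" "s \<notin> A v1" "s \<notin> N"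
        using disj A_iff by (auto simp: N_def)
      with 3 on_cell[OF vs(2)] show ?thesis
        by (simp add: ricci_along_def K_def)
    next
      case 4
      then have "s \<in> I" "s \<notin> A v1" "s \<notin> A v2"
        by (auto simp: N_def)
      with 4 on_boundary show ?thesis
        by (simp add: ricci_along_def K_def)
    qed
  qed
  \<comment> \<open>Finite measure of \<open>B\<close> gives integrability, so the four terms of the
    step function can be integrated separately.\<close>
  have int: "has_bochner_integral lebesgue (\<lambda>s. k * indicator B s) (k * measure lebesgue B)"
    if "B \<in> lmeasurable" for k :: real and B :: "real set"
    using that
    by (intro has_bochner_integral_mult_right has_bochner_integral_real_indicator)
      (auto simp: fmeasurable_def)
  have "has_bochner_integral lebesgue
      (\<lambda>s. indicator I s *\<^sub>R ricci_along T d V l \<theta> (arc_point d l s))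
      (R v1 / 2 * measure lebesgue (A v1) + R v2 / 2 * measure lebesgue (A v2)
       + c / 2 * measure lebesgue N - K * measure lebesgue I)"
    unfolding step
    by (intro has_bochner_integral_add has_bochner_integral_diff int A_meas vs N I)
  \<comment> \<open>The unspecified constant \<open>c\<close> drops out here, being multiplied by
    the measure 0 of \<open>N\<close>.\<close>
  then have "(LINT s:I|lebesgue. ricci_along T d V l \<theta> (arc_point d l s)) =
      R v1 / 2 * length_in d l (V v1) + R v2 / 2 * length_in d l (V v2) - K * L"
    unfolding set_lebesgue_integral_def
    by (simp add: has_bochner_integral_integral_eq N(2) I(2) length_in_def A_def)
  then show ?thesis
    \<comment> \<open>Since \<open>L\<close> is nonzero, dividing by it turns \<open>K * L\<close>
      into \<open>K\<close> and produces the factor \<open>1 / (2 * L)\<close>.\<close>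
    using Lpos
    by (simp add: average_ricci_def edge_average_def field_simps
        flip: L_def I_def R_def K_def)
qed

end
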